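(* Let $g$ be a weight function with constants $c_1,c_\gamma,c_r$, let $x^{old}\in S^0$, $s^{old}=s(x^{old})$, $t\in\mathbb{R}$, and let \[ x^{new}=x^{old}-\frac{1}{1+c_r}h_t(x^{old},g(s^{old})),\qquad s^{new}=s(x^{new}). \] If $\delta_t:=\delta_t(x^{old},g(s^{old}))\leq\frac{1}{80c_\gamma c_r}$, then \[ \delta_t(x^{new},g(s^{new}))\leq\Big(1-\frac{1}{4c_r}\Big)\delta_t(x^{old},g(s^{old})). \]
   Context: Let $A\in\mathbb{R}^{m\times n}$ have full column rank, $b\in\mathbb{R}^m$, $c\in\mathbb{R}^n$, $S^0=\{x:Ax>b\}$, $s(x)=Ax-b$; capital letters denote diagonal matrices of the corresponding vectors; $\|y\|_M=\sqrt{y^TMy}$, and for a matrix $B$, $\|B\|_M$ is the induced operator norm. Newton step $h_t(x,w)=(A^TS^{-1}WS^{-1}A)^{-1}(tc-A^TS^{-1}w)$ and centrality $\delta_t(x,w)=\|tc-A^TS^{-1}w\|_{(A^TS^{-1}WS^{-1}A)^{-1}}$ with $s=s(x)$. With $P_M(w)=W^{1/2}M(M^TWM)^{-1}M^TW^{1/2}$, the slack sensitivity of $s,w\in\mathbb{R}^m_{>0}$ is $\gamma(s,w)=\max_{i}\|W^{-1/2}\mathbf{1}_i\|_{P_{S^{-1}A}(w)}$. A weight function is a differentiable $g:\mathbb{R}^m_{>0}\to\mathbb{R}^m_{>0}$ (with $G(s)=\mathrm{diag}(g(s))$ and Jacobian $G'(s)$) with constants $c_1,c_\gamma,c_r$ such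 that for all $s\in\mathbb{R}^m_{>0}$: $\|g(s)\|_1\leq c_1$; $c_\gamma\geq1$ and $\gamma(s,g(s))\leq c_\gamma$; $c_r\geq1$ and for all $r\geq c_r$, $y\in\mathbb{R}^m$: $\|I+r^{-1}G(s)^{-1}G'(s)S\|_{G(s)}\leq1$ and $\|(I+r^{-1}G(s)^{-1}G'(s)S)y\|_\infty\leq\|y\|_\infty+c_r\|y\|_{G(s)}$; and $\|g(s)\|_\infty\leq2$. *)

theory Defs
  imports "HOL-Analysis.Analysis"
begin

definition diag :: "real^'m \<Rightarrow> real^'m^'m"
  where "diag v = (\<chi> i j. if i = j then v $ i else 0)"

definition vec_sqrt :: "real^'m \<Rightarrow> real^'m"
  where "vec_sqrt v = (\<chi> i. sqrt (v $ i))"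

definition positive_orthant :: "(real^'m) set"
  where "positive_orthant = {v. \<forall>i. 0 < v $ i}"

definition one_norm :: "real^'m \<Rightarrow> real"
  where "one_norm v = (\<Sum>i\<in>UNIV. \<bar>v $ i\<bar>)"

definition mat_norm :: "real^'k^'k \<Rightarrow> real^'k \<Rightarrow> real"
  where "mat_norm M y = sqrt (y \<bullet> (M *v y))"

text \<open>The real supremum below is only meaningful when the set of quotients is bounded above,
  which is the case whenever \<open>M\<close> is positive definite; it is only used for such \<open>M\<close>.\<close>

definition mat_opnorm :: "real^'k^'k \<Rightarrow> real^'k^'k \<Rightarrow> real"
  where "mat_opnorm M B = (SUP y\<in>{y. y \<noteq> 0}. mat_norm M (B *v y) / mat_norm M y)"

definition slack :: "real^'n^'m \<Rightarrow> real^'m \<Rightarrow> real^'n \<Rightarrow> real^'m"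
  where "slack A b x = A *v x - b"

definition interior_region :: "real^'n^'m \<Rightarrow> real^'m \<Rightarrow> (real^'n) set"
  where "interior_region A b = {x. \<forall>i. b $ i < (A *v x) $ i}"

definition hess :: "real^'n^'m \<Rightarrow> real^'m \<Rightarrow> real^'m \<Rightarrow> real^'n^'n"
  where "hess A s w =
    transpose A ** matrix_inv (diag s) ** diag w ** matrix_inv (diag s) ** A"

definition grad :: "real^'n^'m \<Rightarrow> real^'n \<Rightarrow> real \<Rightarrow> real^'m \<Rightarrow> real^'m \<Rightarrow> real^'n"
  where "grad A c t s w = t *\<^sub>R c - (transpose A ** matrix_inv (diag s)) *v w"

definition newton_step ::
    "real^'n^'m \<Rightarrow> real^'m \<Rightarrow> real^'n \<Rightarrow> real \<Rightarrow> real^'n \<Rightarrow> real^'m \<Rightarrow> real^'n"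
  where "newton_step A b c t x w =
    matrix_inv (hess A (slack A b x) w) *v grad A c t (slack A b x) w"

definition centrality ::
    "real^'n^'m \<Rightarrow> real^'m \<Rightarrow> real^'n \<Rightarrow> real \<Rightarrow> real^'n \<Rightarrow> real^'m \<Rightarrow> real"
  where "centrality A b c t x w =
    mat_norm (matrix_inv (hess A (slack A b x) w)) (grad A c t (slack A b x) w)"

definition proj_mat :: "real^'n^'m \<Rightarrow> real^'m \<Rightarrow> real^'m^'m"
  where "proj_mat M w =
    diag (vec_sqrt w) ** M ** matrix_inv (transpose M ** diag w ** M) ** transpose M
      ** diag (vec_sqrt w)"

definition slack_sensitivity :: "real^'n^'m \<Rightarrow> real^'m \<Rightarrow> real^'m \<Rightarrow> real"
  where "slack_sensitivity A s w =
    Max (range (\<lambda>i. mat_norm (proj_mat (matrix_inv (diag s) ** A) w)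
                       (matrix_inv (diag (vec_sqrt w)) *v axis i 1)))"

definition step_matrix :: "(real^'m \<Rightarrow> real^'m) \<Rightarrow> real \<Rightarrow> real^'m \<Rightarrow> real^'m^'m"
  where "step_matrix g r s =
    mat 1 + inverse r *\<^sub>R (matrix_inv (diag (g s)) ** jacobian g (at s) ** diag s)"

text \<open>Only the values of \<open>g\<close> on the positive orthant are constrained. That set is open, so
  differentiability at its points does not depend on values of \<open>g\<close> outside it.\<close>

definition weight_function ::
    "real^'n^'m \<Rightarrow> (real^'m \<Rightarrow> real^'m) \<Rightarrow> real \<Rightarrow> real \<Rightarrow> real \<Rightarrow> bool"
  where "weight_function A g c1 c\<gamma> cr \<longleftrightarrow>
    c\<gamma> \<ge> 1 \<and> cr \<ge> 1 \<and>
    (\<forall>s\<in>positive_orthant.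
       g s \<in> positive_orthant \<and>
       g differentiable (at s) \<and>
       one_norm (g s) \<le> c1 \<and>
       slack_sensitivity A s (g s) \<le> c\<gamma> \<and>
       (\<forall>r\<ge>cr. \<forall>y.
          mat_opnorm (diag (g s)) (step_matrix g r s) \<le> 1 \<and>
          infnorm (step_matrix g r s *v y) \<le> infnorm y + cr * mat_norm (diag (g s)) y) \<and>
       infnorm (g s) \<le> 2)"

end

theory Submission
  imports Defs
begin

text \<open>
  Let \<open>u = S\<^sup>-\<^sup>1 A h\<close> be the relative slack change of the old Newton step, \<open>v\<close> that of the Newton step at the
  new point, and \<open>\<tau> = 1 / (1 + cr)\<close>. Then \<open>\<delta>\<close> and \<open>d\<close>, the old and new centralities, are the norms of \<open>u\<close>
  and \<open>v\<close> weighted by \<open>g(s_old)\<close> and \<open>g(s_new)\<close>, and the slack sensitivity bounds the sup norms by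
  \<open>c\<gamma> \<delta>\<close> and \<open>c\<gamma> d\<close>. Eliminating \<open>t c\<close> from the two Newton equations gives
  \<open>d\<^sup>2 = \<Sum> v (g(s_old) (1 + u) (1 - \<tau> u) - g(s_new))\<close>. The mean value theorem along the segment of slacks
  expresses the change of \<open>\<Sum> v g\<close> by \<open>G' S y = cr G (B - I) y\<close>, where \<open>B\<close> is the step matrix and \<open>y\<close> is
  close to \<open>u\<close>. The parts linear in \<open>u\<close> cancel, and since \<open>B\<close> is a contraction for the weighted norm there
  remains \<open>cr / (1 + cr) d \<delta> = (1 - \<tau>) d \<delta>\<close>. All errors, including those from comparing the weighted norms
  along the segment, carry a sup norm of \<open>u\<close> or \<open>v\<close> and are small multiples of \<open>\<tau> d \<delta>\<close>.
\<close>

section \<open>Diagonal matrices and the norms weighted by them\<close>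

lemma diag_mult_vec_nth [simp]: "(diag w *v y) $ i = w $ i * y $ i"
  by (simp add: diag_def matrix_vector_mult_def if_distrib [of "\<lambda>x. x * _"] cong: if_cong)

lemma mat_norm_diag: "mat_norm (diag w) y = sqrt (\<Sum>i\<in>UNIV. w $ i * (y $ i)\<^sup>2)"
  by (simp add: mat_norm_def inner_vec_def power2_eq_square mult_ac)

lemma positive_orthantD:
  assumes "w \<in> positive_orthant"
  shows "0 < w $ i" "0 \<le> w $ i" "w $ i \<noteq> 0"
proof -
  show "0 < w $ i" using assms by (simp add: positive_orthant_def)
  then show "0 \<le> w $ i" "w $ i \<noteq> 0" by auto
qed

lemma mat_norm_diag_nonneg:
  assumes "w \<in> positive_orthant"
  shows "0 \<le> mat_norm (diag w) y"
  by (simp add: mat_norm_diag sum_nonneg positive_orthantD [OF assms])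

lemma mat_norm_diag_power2:
  assumes "w \<in> positive_orthant"
  shows "(mat_norm (diag w) y)\<^sup>2 = (\<Sum>i\<in>UNIV. w $ i * (y $ i)\<^sup>2)"
proof -
  have "0 \<le> (\<Sum>i\<in>UNIV. w $ i * (y $ i)\<^sup>2)"
    by (simp add: sum_nonneg positive_orthantD [OF assms])
  then show ?thesis by (simp add: mat_norm_diag)
qed

lemma mat_norm_diag_pos:
  assumes "w \<in> positive_orthant" "y \<noteq> 0"
  shows "0 < mat_norm (diag w) y"
proof -
  obtain j where "y $ j \<noteq> 0" using assms(2) by (auto simp: vec_eq_iff)
  then have "0 < (\<Sum>i\<in>UNIV. w $ i * (y $ i)\<^sup>2)"
    by (intro sum_pos2 [of _ j]) (simp_all add: positive_orthantD [OF assms(1)])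
  then show ?thesis by (simp add: mat_norm_diag)
qed

lemma mat_norm_diag_Cauchy_Schwarz:
  assumes "w \<in> positive_orthant"
  shows "(\<Sum>i\<in>UNIV. w $ i * \<bar>y $ i\<bar> * \<bar>z $ i\<bar>) \<le> mat_norm (diag w) y * mat_norm (diag w) z"
proof -
  have w: "0 \<le> w $ i" for i by (rule positive_orthantD [OF assms])
  have "(\<Sum>i\<in>UNIV. \<bar>sqrt (w $ i) * y $ i\<bar> * \<bar>sqrt (w $ i) * z $ i\<bar>)
      \<le> L2_set (\<lambda>i. sqrt (w $ i) * y $ i) UNIV * L2_set (\<lambda>i. sqrt (w $ i) * z $ i) UNIV"
    by (rule L2_set_mult_ineq)
  moreover have "\<bar>sqrt (w $ i) * y $ i\<bar> * \<bar>sqrt (w $ i) * z $ i\<bar> = w $ i * \<bar>y $ i\<bar> * \<bar>z $ i\<bar>" for i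
    using w [of i] real_sqrt_mult_self [of "w $ i"] by (simp add: abs_mult mult_ac)
  ultimately show ?thesis
    using w by (simp add: L2_set_def mat_norm_diag power_mult_distrib)
qed

lemma mat_norm_diag_mono:
  assumes "w \<in> positive_orthant" "0 \<le> C" "\<And>i. \<bar>y $ i\<bar> \<le> C * \<bar>z $ i\<bar>"
  shows "mat_norm (diag w) y \<le> C * mat_norm (diag w) z"
proof (rule power2_le_imp_le)
  have "w $ i * (y $ i)\<^sup>2 \<le> C\<^sup>2 * (w $ i * (z $ i)\<^sup>2)" for i
  proof -
    have "(y $ i)\<^sup>2 \<le> (C * \<bar>z $ i\<bar>)\<^sup>2"
      by (metis abs_ge_zero assms(3) power2_abs power_mono)
    then have "w $ i * (y $ i)\<^sup>2 \<le> w $ i * (C * \<bar>z $ i\<bar>)\<^sup>2"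
      using positive_orthantD [OF assms(1)] by (intro mult_left_mono)
    then show ?thesis by (simp add: power_mult_distrib mult_ac)
  qed
  then show "(mat_norm (diag w) y)\<^sup>2 \<le> (C * mat_norm (diag w) z)\<^sup>2"
    by (simp add: power_mult_distrib mat_norm_diag_power2 assms(1) sum_distrib_left sum_mono)
qed (simp add: assms mat_norm_diag_nonneg)

text \<open>\<open>mat_opnorm\<close> is a real supremum, so it dominates a quotient only once the
  quotients are known to be bounded above. Scaling by the square roots of the weights turns the
  weighted norm into the Euclidean one, where linear maps are bounded.\<close>

lemma mat_opnorm_diag_bound:
  fixes B :: "real^'m^'m"
  assumes w: "w \<in> positive_orthant"
  shows "mat_norm (diag w) (B *v y) \<le> mat_opnorm (diag w) B * mat_norm (diag w) y"
proof (cases "y = 0")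
  case True
  then show ?thesis by (simp add: mat_norm_diag)
next
  case False
  have eq: "mat_norm (diag w) x = norm (diag (vec_sqrt w) *v x)" for x
    by (simp add: mat_norm_diag norm_vec_def L2_set_def vec_sqrt_def positive_orthantD [OF w]
        power_mult_distrib)
  let ?i = "diag (\<chi> i. inverse (sqrt (w $ i)))"
  obtain K where K: "\<And>x. norm (diag (vec_sqrt w) *v (B *v x)) \<le> norm x * K"
    using bounded_linear.bounded [OF matrix_vector_mul_bounded_linear [of "diag (vec_sqrt w) ** B"]]
    by (auto simp: matrix_vector_mul_assoc)
  \<comment> \<open>\<open>?i\<close> undoes the scaling, so \<open>L\<close> bounds the Euclidean
    norm by a multiple of the weighted norm.\<close>
  obtain L where L: "0 < L" "\<And>x. norm (?i *v x) \<le> norm x * L"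
    using bounded_linear.pos_bounded [OF matrix_vector_mul_bounded_linear [of ?i]] by auto
  have inv: "?i *v (diag (vec_sqrt w) *v x) = x" for x
  proof -
    have "w $ i \<noteq> 0" for i by (rule positive_orthantD [OF w])
    then show ?thesis by (simp add: vec_eq_iff vec_sqrt_def)
  qed
  have bdd: "bdd_above ((\<lambda>y. mat_norm (diag w) (B *v y) / mat_norm (diag w) y) ` {y. y \<noteq> 0})"
  proof (rule bdd_aboveI2)
    fix x :: "real^'m" assume x: "x \<in> {y. y \<noteq> 0}"
    have "norm (diag (vec_sqrt w) *v (B *v x)) \<le> norm x * \<bar>K\<bar>"
      using K [of x] by (smt (verit) mult_left_mono norm_ge_zero)
    also have "\<dots> \<le> (mat_norm (diag w) x * L) * \<bar>K\<bar>"
      using L(2) [of "diag (vec_sqrt w) *v x"] by (intro mult_right_mono) (auto simp: inv eq)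
    finally show "mat_norm (diag w) (B *v x) / mat_norm (diag w) x \<le> L * \<bar>K\<bar>"
      using mat_norm_diag_pos [OF w, of x] x by (simp add: eq [of "B *v x"] divide_le_eq mult_ac)
  qed
  have "mat_norm (diag w) (B *v y) / mat_norm (diag w) y \<le> mat_opnorm (diag w) B"
    unfolding mat_opnorm_def by (rule cSUP_upper [OF _ bdd]) (use False in simp)
  then show ?thesis using mat_norm_diag_pos [OF w False] by (simp add: divide_le_eq)
qed

section \<open>Matrix inverses and transposes\<close>

lemma matrix_inv_mult:
  assumes "invertible A"
  shows "A ** matrix_inv A = mat 1" "matrix_inv A ** A = mat 1"
  using someI_ex [OF assms [unfolded invertible_def]] by (simp_all add: matrix_inv_def)

lemma matrix_inv_unique:
  assumes "A ** B = mat 1" "B ** A = mat 1"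
  shows "matrix_inv A = B"
proof -
  have "invertible A" using assms by (auto simp: invertible_def)
  then have "matrix_inv A = matrix_inv A ** (A ** B)" by (simp add: assms)
  also have "\<dots> = B" using \<open>invertible A\<close> by (simp add: matrix_mul_assoc matrix_inv_mult)
  finally show ?thesis .
qed

lemma matrix_inv_diag:
  fixes s :: "real^'m"
  assumes "\<And>i. s $ i \<noteq> 0"
  shows "matrix_inv (diag s) = diag (\<chi> i. inverse (s $ i))"
proof -
  have "diag s ** diag (\<chi> i. inverse (s $ i)) = mat 1"
       "diag (\<chi> i. inverse (s $ i)) ** diag s = mat 1"
    using assms by (simp_all add: matrix_eq vec_eq_iff flip: matrix_vector_mul_assoc)
  then show ?thesis by (rule matrix_inv_unique)
qed

lemma transpose_diag [simp]: "transpose (diag w) = diag w"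
  by (auto simp: transpose_def diag_def vec_eq_iff)

lemma inner_vector_matrix: "x \<bullet> (y v* A) = (A *v x) \<bullet> y" for A :: "real^'n^'m"
  by (metis dot_lmul_matrix inner_commute)

lemma inner_matrix_transpose: "x \<bullet> (transpose A *v y) = (A *v x) \<bullet> y" for A :: "real^'n^'m"
  by (simp add: inner_vector_matrix)

lemma matrix_inv_mult_vec:
  fixes H :: "real^'n^'n"
  assumes "invertible H"
  shows "H *v (matrix_inv H *v x) = x" "matrix_inv H *v (H *v x) = x"
  using assms by (simp_all add: matrix_vector_mul_assoc matrix_inv_mult)

section \<open>Newton step and slack sensitivity in terms of relative slack changes\<close>

lemma inner_hess:
  assumes "s \<in> positive_orthant"
  shows "x \<bullet> (hess A s w *v y) = (\<Sum>i\<in>UNIV. w $ i * ((A *v x) $ i / s $ i) * ((A *v y) $ i / s $ i))"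
proof -
  have s: "s $ i \<noteq> 0" for i by (rule positive_orthantD [OF assms])
  show ?thesis
    by (simp add: hess_def matrix_inv_diag s inner_vector_matrix inner_vec_def [of "A *v x"] divide_inverse mult_ac
        flip: matrix_vector_mul_assoc)
qed

text \<open>Passes from the Hessian norm on the variables to a weighted norm of relative slack
  changes, in which all later estimates are carried out.\<close>

lemma sqrt_inner_hess:
  assumes "s \<in> positive_orthant"
  shows "sqrt (x \<bullet> (hess A s w *v x)) = mat_norm (diag w) (\<chi> i. (A *v x) $ i / s $ i)"
  by (simp only: inner_hess [OF assms] mat_norm_diag vec_lambda_beta power2_eq_square mult.assoc)

lemma inner_grad:
  assumes "s \<in> positive_orthant"
  shows "x \<bullet> grad A c t s w = t * (x \<bullet> c) - (\<Sum>i\<in>UNIV. w $ i * ((A *v x) $ i / s $ i))"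
proof -
  have s: "s $ i \<noteq> 0" for i by (rule positive_orthantD [OF assms])
  show ?thesis
    by (simp add: grad_def matrix_inv_diag s inner_vector_matrix inner_diff_right inner_vec_def [of "A *v x"]
        divide_inverse mult_ac flip: matrix_vector_mul_assoc)
qed

text \<open>A kernel vector has vanishing quadratic form, so positivity of the weights forces
  \<open>A *v x = 0\<close>, and full column rank then gives \<open>x = 0\<close>.\<close>

lemma invertible_hess:
  fixes A :: "real^'n^'m"
  assumes "rank A = CARD('n)" and s: "s \<in> positive_orthant" and w: "w \<in> positive_orthant"
  shows "invertible (hess A s w)"
proof -
  have "x = 0" if "hess A s w *v x = 0" for x
  proof -
    have "mat_norm (diag w) (\<chi> i. (A *v x) $ i / s $ i) = 0"
      using that sqrt_inner_hess [OF s, of x A w] by simp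
    then have "(\<chi> i. (A *v x) $ i / s $ i) = 0"
      using mat_norm_diag_pos [OF w] by (metis less_irrefl)
    then have "A *v x = 0" by (simp add: vec_eq_iff positive_orthantD [OF s])
    moreover have "inj ((*v) A)" using assms(1) full_rank_injective by blast
    ultimately show "x = 0" by (metis injD matrix_vector_mult_0_right)
  qed
  then show ?thesis by (metis invertible_left_inverse matrix_left_invertible_ker)
qed

text \<open>\<open>a\<close> is row \<open>i\<close> of \<open>S^-1 A\<close>. The scaling of the
  unit vector by \<open>W^(-1/2)\<close> cancels the outer factors \<open>W^(1/2)\<close> of the
  projection, so what remains is the norm of that row in the inverse Hessian.\<close>

lemma slack_sensitivity_ge:
  fixes A :: "real^'n^'m"
  assumes s: "s \<in> positive_orthant" and w: "w \<in> positive_orthant"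
    and a_def: "a = transpose A *v ((1 / s $ i) *\<^sub>R axis i 1)"
  shows "sqrt (a \<bullet> (matrix_inv (hess A s w) *v a)) \<le> slack_sensitivity A s w"
proof -
  have s0: "s $ i \<noteq> 0" for i by (rule positive_orthantD [OF s])
  have w0: "w $ i > 0" for i by (rule positive_orthantD [OF w])
  have w1: "vec_sqrt w $ i \<noteq> 0" for i using w0 [of i] by (simp add: vec_sqrt_def)
  let ?M = "diag (\<chi> i. inverse (s $ i)) ** A"
  have H: "transpose ?M ** diag w ** ?M = hess A s w"
    by (simp add: hess_def matrix_inv_diag s0 matrix_transpose_mul matrix_mul_assoc)
  let ?e = "matrix_inv (diag (vec_sqrt w)) *v (axis i 1 :: real^'m)"
  have e: "diag (vec_sqrt w) *v ?e = axis i 1"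
    by (simp add: matrix_inv_diag w1 vec_eq_iff)
  have a: "transpose ?M *v axis i 1 = a"
  proof -
    have "diag (\<chi> i. inverse (s $ i)) *v axis i 1 = (1 / s $ i) *\<^sub>R axis i 1"
      by (simp add: vec_eq_iff axis_def divide_inverse)
    then show ?thesis by (simp add: a_def matrix_transpose_mul flip: matrix_vector_mul_assoc)
  qed
  have "?e \<bullet> (proj_mat ?M w *v ?e) = ?e \<bullet> (transpose (diag (vec_sqrt w)) *v (?M *v (matrix_inv (hess A s w) *v a)))"
    unfolding proj_mat_def H by (simp only: matrix_vector_mul_assoc [symmetric] e transpose_diag) (simp only: matrix_vector_mul_assoc a)
  also have "\<dots> = axis i 1 \<bullet> (transpose (transpose ?M) *v (matrix_inv (hess A s w) *v a))"
    by (simp only: inner_matrix_transpose e transpose_transpose)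
  also have "\<dots> = a \<bullet> (matrix_inv (hess A s w) *v a)"
    by (simp only: inner_matrix_transpose a)
  finally have "sqrt (a \<bullet> (matrix_inv (hess A s w) *v a)) =
     mat_norm (proj_mat (matrix_inv (diag s) ** A) w) ?e"
    by (simp add: mat_norm_def matrix_inv_diag s0)
  also have "\<dots> \<le> slack_sensitivity A s w"
    unfolding slack_sensitivity_def by (intro Max_ge) auto
  finally show ?thesis .
qed

text \<open>The second claim is the Newton equation tested against an arbitrary direction
  \<open>k\<close>. The third writes \<open>u $ i\<close> as a Hessian inner product and applies
  Cauchy-Schwarz.\<close>

lemma newton_step_properties:
  fixes A :: "real^'n^'m"
  assumes "rank A = CARD('n)" and s: "s \<in> positive_orthant" and w: "w \<in> positive_orthant"
    and sx: "s = slack A b x"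
    and u_def: "u = (\<chi> i. (A *v newton_step A b c t x w) $ i / s $ i)"
  shows centrality_eq: "centrality A b c t x w = mat_norm (diag w) u"
    and newton_step_inner:
      "(\<Sum>i\<in>UNIV. w $ i * u $ i * ((A *v k) $ i / s $ i))
        = t * (k \<bullet> c) - (\<Sum>i\<in>UNIV. w $ i * ((A *v k) $ i / s $ i))"
    and newton_step_le: "\<bar>u $ i\<bar> \<le> slack_sensitivity A s w * centrality A b c t x w"
proof -
  define h where "h = newton_step A b c t x w"
  define H where "H = hess A s w"
  have inv: "invertible H" unfolding H_def by (rule invertible_hess) fact+
  have Hh: "H *v h = grad A c t s w"
    unfolding h_def newton_step_def sx [symmetric] H_def [symmetric] by (rule matrix_inv_mult_vec [OF inv])
  have "centrality A b c t x w = sqrt (h \<bullet> (H *v h))"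
    unfolding centrality_def mat_norm_def Hh unfolding h_def newton_step_def H_def sx [symmetric]
    by (simp only: inner_commute)
  also have "\<dots> = mat_norm (diag w) u"
    unfolding H_def u_def h_def by (rule sqrt_inner_hess [OF s])
  finally show c: "centrality A b c t x w = mat_norm (diag w) u" .
  show "(\<Sum>i\<in>UNIV. w $ i * u $ i * ((A *v k) $ i / s $ i))
        = t * (k \<bullet> c) - (\<Sum>i\<in>UNIV. w $ i * ((A *v k) $ i / s $ i))"
    using arg_cong [OF Hh, of "\<lambda>z. k \<bullet> z"]
    by (simp add: H_def inner_hess s inner_grad u_def h_def mult_ac)
  define a where "a = transpose A *v ((1 / s $ i) *\<^sub>R axis i 1)"
  \<comment> \<open>\<open>l\<close> represents the functional "inner product with row
    \<open>i\<close>" in the Hessian inner product; its Hessian norm is the quantity bounded by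
    \<open>slack_sensitivity_ge\<close>.\<close>
  define l where "l = matrix_inv H *v a"
  define q where "q = (\<chi> i. (A *v l) $ i / s $ i)"
  have "u $ i = h \<bullet> a"
    unfolding a_def inner_matrix_transpose u_def h_def by (simp add: inner_axis)
  also have "\<dots> = h \<bullet> (H *v l)"
    unfolding l_def by (simp only: matrix_inv_mult_vec [OF inv])
  also have "\<dots> = (\<Sum>i\<in>UNIV. w $ i * q $ i * u $ i)"
    unfolding H_def inner_hess [OF s] by (simp add: q_def u_def h_def mult_ac)
  also have "\<bar>\<dots>\<bar> \<le> (\<Sum>i\<in>UNIV. w $ i * \<bar>q $ i\<bar> * \<bar>u $ i\<bar>)"
    by (intro order_trans [OF sum_abs] sum_mono) (simp add: positive_orthantD [OF w] abs_mult)
  also have "\<dots> \<le> mat_norm (diag w) q * mat_norm (diag w) u"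
    by (rule mat_norm_diag_Cauchy_Schwarz [OF w])
  also have "mat_norm (diag w) q = sqrt (l \<bullet> (H *v l))"
    unfolding H_def q_def by (rule sqrt_inner_hess [OF s, symmetric])
  also have "\<dots> = sqrt (a \<bullet> (matrix_inv H *v a))"
    unfolding l_def matrix_inv_mult_vec [OF inv] by (simp only: inner_commute)
  also have "\<dots> * mat_norm (diag w) u \<le> slack_sensitivity A s w * mat_norm (diag w) u"
    unfolding H_def
    by (rule mult_right_mono [OF slack_sensitivity_ge [OF s w a_def] mat_norm_diag_nonneg [OF w]])
  finally show "\<bar>u $ i\<bar> \<le> slack_sensitivity A s w * centrality A b c t x w" by (simp add: c)
qed

section \<open>Estimates for weighted sums and elementary real inequalities\<close>

text \<open>Will bound derivatives of weighted sums along the path, with \<open>C\<close> coming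
  from a sup-norm bound. The factor 2 arises because the \<open>y\<close> and \<open>z\<close> parts
  are estimated separately, each by the norm of \<open>y\<close>.\<close>

lemma weighted_sum_diff_bound:
  assumes w: "w \<in> positive_orthant" and "0 \<le> C" and f: "\<And>i. \<bar>f i\<bar> \<le> C * \<bar>p $ i\<bar>"
    and z: "mat_norm (diag w) z \<le> mat_norm (diag w) y"
  shows "\<bar>\<Sum>i\<in>UNIV. w $ i * f i * (y $ i - z $ i)\<bar> \<le> 2 * C * mat_norm (diag w) p * mat_norm (diag w) y"
proof -
  have "\<bar>w $ i * f i * (y $ i - z $ i)\<bar> \<le>
      C * (w $ i * \<bar>p $ i\<bar> * \<bar>y $ i\<bar>) + C * (w $ i * \<bar>p $ i\<bar> * \<bar>z $ i\<bar>)" for i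
  proof -
    have "\<bar>w $ i * f i * (y $ i - z $ i)\<bar> = w $ i * (\<bar>f i\<bar> * \<bar>y $ i - z $ i\<bar>)"
      using positive_orthantD [OF w] by (simp add: abs_mult)
    also have "\<dots> \<le> w $ i * ((C * \<bar>p $ i\<bar>) * (\<bar>y $ i\<bar> + \<bar>z $ i\<bar>))"
      using positive_orthantD [OF w] f assms(2) by (intro mult_left_mono mult_mono) auto
    finally show ?thesis by (simp add: algebra_simps)
  qed
  then have "\<bar>\<Sum>i\<in>UNIV. w $ i * f i * (y $ i - z $ i)\<bar> \<le>
      C * (\<Sum>i\<in>UNIV. w $ i * \<bar>p $ i\<bar> * \<bar>y $ i\<bar>) + C * (\<Sum>i\<in>UNIV. w $ i * \<bar>p $ i\<bar> * \<bar>z $ i\<bar>)"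
    unfolding sum_distrib_left sum.distrib [symmetric] by (intro order_trans [OF sum_abs] sum_mono)
  also have "\<dots> \<le> C * (mat_norm (diag w) p * mat_norm (diag w) y) + C * (mat_norm (diag w) p * mat_norm (diag w) y)"
  proof (intro add_mono mult_left_mono assms(2) mat_norm_diag_Cauchy_Schwarz [OF w])
    show "(\<Sum>i\<in>UNIV. w $ i * \<bar>p $ i\<bar> * \<bar>z $ i\<bar>) \<le> mat_norm (diag w) p * mat_norm (diag w) y"
      by (rule order_trans [OF mat_norm_diag_Cauchy_Schwarz [OF w]])
        (intro mult_left_mono z mat_norm_diag_nonneg w)
  qed
  finally show ?thesis by simp
qed

lemma weighted_product_sum_bound:
  assumes w: "w \<in> positive_orthant" and "0 \<le> C" and f: "\<And>i. \<bar>f i\<bar> \<le> C * \<bar>p $ i\<bar>"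
  shows "\<bar>\<Sum>i\<in>UNIV. w $ i * v $ i * f i\<bar> \<le> C * (mat_norm (diag w) v * mat_norm (diag w) p)"
proof -
  have "\<bar>w $ i * v $ i * f i\<bar> \<le> C * (w $ i * \<bar>v $ i\<bar> * \<bar>p $ i\<bar>)" for i
    using mult_left_mono [OF f [of i], of "w $ i * \<bar>v $ i\<bar>"] positive_orthantD [OF w]
    by (simp add: abs_mult mult_ac)
  then have "\<bar>\<Sum>i\<in>UNIV. w $ i * v $ i * f i\<bar> \<le> C * (\<Sum>i\<in>UNIV. w $ i * \<bar>v $ i\<bar> * \<bar>p $ i\<bar>)"
    unfolding sum_distrib_left by (intro order_trans [OF sum_abs] sum_mono)
  also have "\<dots> \<le> C * (mat_norm (diag w) v * mat_norm (diag w) p)"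
    by (intro mult_left_mono assms(2) mat_norm_diag_Cauchy_Schwarz [OF w])
  finally show ?thesis .
qed

lemma derivative_bound_imp_Lipschitz:
  fixes f f' :: "real \<Rightarrow> real"
  assumes "\<And>x. a \<le> x \<Longrightarrow> x \<le> b \<Longrightarrow> (f has_real_derivative f' x) (at x)"
    and "\<And>x. a \<le> x \<Longrightarrow> x \<le> b \<Longrightarrow> \<bar>f' x\<bar> \<le> L"
    and "x \<in> {a..b}" "y \<in> {a..b}"
  shows "\<bar>f x - f y\<bar> \<le> L * \<bar>x - y\<bar>"
proof -
  have "norm (f x - f y) \<le> L * norm (x - y)"
    by (rule field_differentiable_bound [of "{a..b}" f f'])
      (use assms in \<open>auto intro: has_field_derivative_at_within\<close>)
  then show ?thesis by simp
qed

text \<open>Merges two relative errors linear in \<open>x\<close> into one of the same shape, using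
  \<open>x * x <= x\<close>. It keeps every error below proportional to
  \<open>\<tau>\<close>.\<close>

lemma one_plus_mult_le:
  fixes a b c x :: real
  assumes "0 \<le> x" "x \<le> 1" "0 \<le> a" "0 \<le> b" "a + b + a * b \<le> c"
  shows "(1 + a * x) * (1 + b * x) \<le> 1 + c * x"
proof -
  have "(1 + a * x) * (1 + b * x) = 1 + (a + b) * x + (a * b) * (x * x)" by (simp add: algebra_simps)
  also have "\<dots> \<le> 1 + (a + b) * x + (a * b) * (x * 1)"
    using assms by (intro add_left_mono mult_left_mono) auto
  also have "\<dots> = 1 + (a + b + a * b) * x" by (simp add: algebra_simps)
  also have "\<dots> \<le> 1 + c * x" using assms by (intro add_left_mono mult_right_mono) auto
  finally show ?thesis .
qed

section \<open>Norms along the path of weights, and the contraction estimate\<close>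

text \<open>Here \<open>w \<theta>\<close> are the weights at the slacks \<open>s \<theta> = s_old (1 - \<theta> u)\<close>, and \<open>z \<theta>\<close> is the image of
  \<open>y \<theta> = - (d/d\<theta>) ln (s \<theta>)\<close> under the step matrix; \<open>u\<close> and \<open>v\<close> are the old and the new Newton step
  relative to the slacks.\<close>

locale weight_path =
  fixes w y z :: "real \<Rightarrow> real^'m" and u v :: "real^'m" and r \<tau> K :: real
  assumes r: "r \<ge> 1" and \<tau>: "\<tau> = 1 / (1 + r)"
    and y: "\<And>\<theta>. y \<theta> = (\<chi> i. u $ i / (1 - \<theta> * u $ i))"
    and w: "\<And>\<theta>. 0 \<le> \<theta> \<Longrightarrow> \<theta> \<le> \<tau> \<Longrightarrow> w \<theta> \<in> positive_orthant"
    and w_deriv: "\<And>\<theta> i. 0 \<le> \<theta> \<Longrightarrow> \<theta> \<le> \<tau> \<Longrightarrow>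
      ((\<lambda>\<theta>. w \<theta> $ i) has_real_derivative r * (w \<theta> $ i * (y \<theta> $ i - z \<theta> $ i))) (at \<theta>)"
    and z: "\<And>\<theta>. 0 \<le> \<theta> \<Longrightarrow> \<theta> \<le> \<tau> \<Longrightarrow> mat_norm (diag (w \<theta>)) (z \<theta>) \<le> mat_norm (diag (w \<theta>)) (y \<theta>)"
    and u_small: "\<And>i. \<bar>u $ i\<bar> \<le> 1 / (80 * r)"
    and v_small: "\<And>i. \<bar>v $ i\<bar> \<le> K * mat_norm (diag (w \<tau>)) v"
    and K: "K * mat_norm (diag (w 0)) u \<le> 1 / (80 * r)" "0 \<le> K"
begin

abbreviation "\<delta> \<equiv> mat_norm (diag (w 0)) u"
abbreviation "d \<equiv> mat_norm (diag (w \<tau>)) v"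

text \<open>The third identity converts the factor \<open>r\<close> of the weight derivative, over a
  path of length \<open>\<tau>\<close>, into \<open>1 - \<tau>\<close>. The fourth holds since
  \<open>1 + r <= 2 * r\<close>, and is the source of the constant 4 in the contraction
  factor.\<close>

lemma \<tau>_bounds: "0 < \<tau>" "\<tau> \<le> 1/2" "r * \<tau> = 1 - \<tau>" "1 / (4 * r) \<le> \<tau> / 2"
  using r by (simp_all add: \<tau> field_simps)

lemma \<delta>_nonneg: "0 \<le> \<delta>" and d_nonneg: "0 \<le> d"
  using \<tau>_bounds(1,2) by (auto intro!: mat_norm_diag_nonneg w)

lemma sum_deriv:
  assumes "0 \<le> \<theta>" "\<theta> \<le> \<tau>"
  shows "((\<lambda>\<theta>. \<Sum>i\<in>UNIV. w \<theta> $ i * f i) has_real_derivative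
    r * (\<Sum>i\<in>UNIV. w \<theta> $ i * f i * (y \<theta> $ i - z \<theta> $ i))) (at \<theta>)"
  unfolding sum_distrib_left
  by (rule derivative_eq_intros w_deriv assms refl)+ (simp add: mult_ac)

lemma u_le: "\<bar>u $ i\<bar> \<le> 1/80"
  using u_small [of i] r by (smt (verit) frac_le)

lemma denominator_bound:
  assumes "0 \<le> \<theta>" "\<theta> \<le> \<tau>"
  shows "100/101 \<le> 1 - \<theta> * u $ i"
proof -
  have "\<bar>\<theta> * u $ i\<bar> \<le> 1/2 * (1/80)"
    unfolding abs_mult using assms \<tau>_bounds(1,2) by (intro mult_mono u_le) auto
  then show ?thesis by linarith
qed

lemma y_minus_u:
  assumes "0 \<le> \<theta>" "\<theta> \<le> \<tau>"
  shows "\<bar>y \<theta> $ i - u $ i\<bar> \<le> \<tau> / 79 * \<bar>u $ i\<bar>"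
proof -
  have D: "100/101 \<le> 1 - \<theta> * u $ i" by (rule denominator_bound [OF assms])
  have "y \<theta> $ i - u $ i = \<theta> * u $ i * u $ i / (1 - \<theta> * u $ i)"
    using D by (simp add: y field_simps)
  then have "\<bar>y \<theta> $ i - u $ i\<bar> = (\<theta> * \<bar>u $ i\<bar>) * \<bar>u $ i\<bar> / (1 - \<theta> * u $ i)"
    using D assms by (simp add: abs_mult abs_divide)
  also have "\<dots> \<le> (\<tau> * (1/80)) * \<bar>u $ i\<bar> / (100/101)"
    using D assms by (intro frac_le mult_right_mono mult_mono u_le) auto
  \<comment> \<open>Numerically \<open>(1/80) / (100/101) = 101/8000 <= 1/79\<close>.\<close>
  also have "\<dots> \<le> \<tau> / 79 * \<bar>u $ i\<bar>"
    using \<tau>_bounds(1,2) by (simp add: mult_right_mono)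
  finally show ?thesis .
qed

lemma y_norm:
  assumes "0 \<le> \<theta>" "\<theta> \<le> \<tau>"
  shows "mat_norm (diag (w \<theta>)) (y \<theta>) \<le> (1 + \<tau> / 79) * mat_norm (diag (w \<theta>)) u"
proof (rule mat_norm_diag_mono [OF w [OF assms]])
  show "\<bar>y \<theta> $ i\<bar> \<le> (1 + \<tau> / 79) * \<bar>u $ i\<bar>" for i
    using y_minus_u [OF assms, of i] unfolding distrib_right by linarith
qed (use \<tau>_bounds(1,2) in simp)

text \<open>The growth rate is controlled by the small sup norm of \<open>u\<close>, through Gronwall's inequality; no
  sup-norm bound on the relative change of the weights is available at this scale.\<close>

lemma u_norm:
  assumes \<theta>: "0 \<le> \<theta>" "\<theta> \<le> \<tau>"
  shows "mat_norm (diag (w \<theta>)) u \<le> (1 + \<tau> / 39) * \<delta>"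
proof -
  define n where "n \<theta> = (\<Sum>i\<in>UNIV. w \<theta> $ i * (u $ i)\<^sup>2)" for \<theta>
  define n' where "n' \<theta> = r * (\<Sum>i\<in>UNIV. w \<theta> $ i * (u $ i)\<^sup>2 * (y \<theta> $ i - z \<theta> $ i))" for \<theta>
  have n_eq: "(mat_norm (diag (w \<theta>)) u)\<^sup>2 = n \<theta>" if "0 \<le> \<theta>" "\<theta> \<le> \<tau>" for \<theta>
    using mat_norm_diag_power2 [OF w [OF that]] by (simp add: n_def)
  have n'_le: "n' \<theta> \<le> n \<theta> / 39" if t: "0 \<le> \<theta>" "\<theta> \<le> \<tau>" for \<theta>
  proof -
    let ?N = "mat_norm (diag (w \<theta>))"
    have N0: "0 \<le> ?N u" by (rule mat_norm_diag_nonneg [OF w [OF t]])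
    have "\<bar>\<Sum>i\<in>UNIV. w \<theta> $ i * (u $ i)\<^sup>2 * (y \<theta> $ i - z \<theta> $ i)\<bar> \<le> 2 * (1 / (80 * r)) * ?N u * ?N (y \<theta>)"
    proof (rule weighted_sum_diff_bound [OF w [OF t] _ _ z [OF t]])
      show "\<bar>(u $ i)\<^sup>2\<bar> \<le> 1 / (80 * r) * \<bar>u $ i\<bar>" for i
        using mult_right_mono [OF u_small [of i], of "\<bar>u $ i\<bar>"] by (simp add: power2_eq_square)
    qed (use r in simp)
    also have "\<dots> \<le> 2 * (1 / (80 * r)) * ?N u * ((1 + \<tau> / 79) * ?N u)"
      using r N0 y_norm [OF t] by (intro mult_left_mono) auto
    finally have "r * (\<Sum>i\<in>UNIV. w \<theta> $ i * (u $ i)\<^sup>2 * (y \<theta> $ i - z \<theta> $ i)) \<le>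
        r * (2 * (1 / (80 * r)) * ?N u * ((1 + \<tau> / 79) * ?N u))"
      using r by (intro mult_left_mono) auto
    \<comment> \<open>The \<open>r\<close> of the derivative cancels against the bound
      \<open>1 / (80 * r)\<close> on \<open>u\<close>, so the growth rate is independent of
      \<open>r\<close>.\<close>
    also have "\<dots> = (1 + \<tau> / 79) / 40 * n \<theta>"
      using r by (simp add: n_eq [OF t, symmetric] power2_eq_square)
    also have "\<dots> \<le> 1 / 39 * n \<theta>"
      using \<tau>_bounds(1,2) by (intro mult_right_mono) (simp_all add: n_eq [OF t, symmetric])
    finally show ?thesis by (simp add: n'_def)
  qed
  \<comment> \<open>\<open>exp (- \<theta> / 39)\<close> is the integrating factor for
    \<open>n' \<theta> \<le> n \<theta> / 39\<close>.\<close>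
  have "n \<theta> * exp (- \<theta> / 39) \<le> n 0 * exp (- 0 / 39)"
  proof (rule DERIV_nonpos_imp_nonincreasing [OF \<theta>(1)])
    fix x assume x: "0 \<le> x" "x \<le> \<theta>"
    have "(n has_real_derivative n' x) (at x)"
      unfolding n_def n'_def using x \<theta> by (intro sum_deriv) auto
    then have "((\<lambda>\<theta>. n \<theta> * exp (- \<theta> / 39)) has_real_derivative (n' x - n x / 39) * exp (- x / 39)) (at x)"
      by (auto intro!: derivative_eq_intros simp: algebra_simps)
    moreover have "(n' x - n x / 39) * exp (- x / 39) \<le> 0"
      using n'_le [of x] x \<theta> by (intro mult_nonpos_nonneg) auto
    ultimately show "\<exists>D. ((\<lambda>\<theta>. n \<theta> * exp (- \<theta> / 39)) has_real_derivative D) (at x) \<and> D \<le> 0" by blast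
  qed
  then have "n \<theta> \<le> n 0 * exp (\<theta> / 39)"
    by (simp add: exp_minus field_simps)
  \<comment> \<open>Since \<open>n\<close> is a squared norm, the growth factor is bounded by a
    square, through \<open>1 + x + x^2 <= (1 + x)^2\<close>.\<close>
  also have "\<dots> \<le> n 0 * (1 + \<tau> / 39)\<^sup>2"
  proof (rule mult_left_mono)
    have "exp (\<theta> / 39) \<le> exp (\<tau> / 39)" using \<theta> by simp
    also have "\<dots> \<le> 1 + \<tau> / 39 + (\<tau> / 39)\<^sup>2"
      using \<tau>_bounds(1,2) by (intro exp_bound) auto
    also have "\<dots> \<le> (1 + \<tau> / 39)\<^sup>2"
      using \<tau>_bounds(1,2) by (simp add: power2_eq_square algebra_simps)
    finally show "exp (\<theta> / 39) \<le> (1 + \<tau> / 39)\<^sup>2" .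
    show "0 \<le> n 0" using n_eq [of 0] \<tau>_bounds(1,2) by (metis less_imp_le order_refl zero_le_power2)
  qed
  finally have "(mat_norm (diag (w \<theta>)) u)\<^sup>2 \<le> ((1 + \<tau> / 39) * \<delta>)\<^sup>2"
    using \<tau>_bounds(1,2) \<theta> by (simp add: n_eq power_mult_distrib mult_ac)
  then show ?thesis
    by (rule power2_le_imp_le) (use \<tau>_bounds(1,2) \<delta>_nonneg in simp)
qed

lemma y_norm_\<delta>:
  assumes \<theta>: "0 \<le> \<theta>" "\<theta> \<le> \<tau>"
  shows "mat_norm (diag (w \<theta>)) (y \<theta>) \<le> (1 + \<tau> / 25) * \<delta>"
proof -
  have "mat_norm (diag (w \<theta>)) (y \<theta>) \<le> (1 + \<tau> / 79) * ((1 + \<tau> / 39) * \<delta>)"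
    by (rule order_trans [OF y_norm [OF \<theta>]]) (intro mult_left_mono u_norm \<theta>, use \<tau>_bounds(1,2) in simp)
  also have "\<dots> \<le> (1 + \<tau> / 25) * \<delta>"
  proof -
    have "(1 + \<tau> / 79) * (1 + \<tau> / 39) \<le> 1 + \<tau> / 25"
      using one_plus_mult_le [of \<tau> "1/79" "1/39" "1/25"] \<tau>_bounds(1,2) by simp
    from mult_right_mono [OF this \<delta>_nonneg] show ?thesis by (simp only: mult.assoc)
  qed
  finally show ?thesis .
qed

text \<open>Here the sup norm of \<open>v\<close> is controlled only by \<open>K * d\<close>, with
  \<open>d\<close> taken at the endpoint. The norm itself, rather than its square, is therefore
  differentiated: dividing by \<open>2 * m x\<close> leaves a constant Lipschitz bound in terms of
  \<open>d\<close>.\<close>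

lemma v_norm:
  assumes \<theta>: "0 \<le> \<theta>" "\<theta> \<le> \<tau>"
  shows "mat_norm (diag (w \<theta>)) v \<le> (1 + \<tau> / 70) * d"
proof (cases "v = 0")
  case True
  then show ?thesis by (simp add: mat_norm_diag)
next
  case False
  define m where "m \<theta> = mat_norm (diag (w \<theta>)) v" for \<theta>
  define n' where "n' \<theta> = (\<Sum>i\<in>UNIV. w \<theta> $ i * (v $ i)\<^sup>2 * (y \<theta> $ i - z \<theta> $ i))" for \<theta>
  have "\<bar>m \<theta> - m \<tau>\<bar> \<le> (d / 70) * \<bar>\<theta> - \<tau>\<bar>"
  proof (rule derivative_bound_imp_Lipschitz)
    fix x assume x: "0 \<le> x" "x \<le> \<tau>"
    \<comment> \<open>Differentiating the square root needs a positive argument, hence the separate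
      case \<open>v = 0\<close>.\<close>
    have pos: "0 < m x" unfolding m_def by (rule mat_norm_diag_pos [OF w [OF x] False])
    then have "0 < (\<Sum>i\<in>UNIV. w x $ i * (v $ i)\<^sup>2)" by (simp add: m_def mat_norm_diag)
    then show "(m has_real_derivative r * n' x / (2 * m x)) (at x)"
      unfolding m_def mat_norm_diag n'_def
      using DERIV_chain2 [OF DERIV_real_sqrt sum_deriv [OF x, of "\<lambda>i. (v $ i)\<^sup>2"]]
      by (simp add: field_simps)
    have "\<bar>n' x\<bar> \<le> 2 * (K * d) * m x * mat_norm (diag (w x)) (y x)"
      unfolding n'_def m_def
    proof (rule weighted_sum_diff_bound [OF w [OF x] _ _ z [OF x]])
      show "\<bar>(v $ i)\<^sup>2\<bar> \<le> K * d * \<bar>v $ i\<bar>" for i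
        using mult_right_mono [OF v_small [of i], of "\<bar>v $ i\<bar>"] by (simp add: power2_eq_square)
    qed (use d_nonneg K in simp)
    also have "\<dots> \<le> 2 * (K * d) * m x * ((1 + \<tau> / 25) * \<delta>)"
      using d_nonneg K pos by (intro mult_left_mono y_norm_\<delta> x) auto
    \<comment> \<open>\<open>K\<close> is regrouped with the \<open>\<delta>\<close> from the norm
      of \<open>y x\<close>: it is the product \<open>K * \<delta>\<close> that is assumed
      small.\<close>
    also have "\<dots> = 2 * m x * d * (1 + \<tau> / 25) * (K * \<delta>)" by simp
    also have "\<dots> \<le> 2 * m x * d * (1 + \<tau> / 25) * (1 / (80 * r))"
      using d_nonneg K pos \<tau>_bounds(1,2) by (intro mult_left_mono) auto
    finally have n': "\<bar>n' x\<bar> \<le> 2 * m x * d * (1 + \<tau> / 25) * (1 / (80 * r))" .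
    have "\<bar>r * n' x / (2 * m x)\<bar> = r * \<bar>n' x\<bar> / (2 * m x)"
      using r pos by (simp add: abs_mult)
    also have "\<dots> \<le> r * (2 * m x * d * (1 + \<tau> / 25) * (1 / (80 * r))) / (2 * m x)"
      using n' r pos by (intro divide_right_mono mult_left_mono) auto
    also have "\<dots> = (1 + \<tau> / 25) / 80 * d"
      using r pos by (simp add: field_simps)
    also have "\<dots> \<le> 1 / 70 * d"
      using \<tau>_bounds(1,2) d_nonneg by (intro mult_right_mono) auto
    finally show "\<bar>r * n' x / (2 * m x)\<bar> \<le> d / 70" by simp
  qed (use \<theta> in auto)
  also have "\<dots> \<le> d / 70 * \<tau>" using \<theta> d_nonneg by (intro mult_left_mono) auto
  finally have "m \<theta> - m \<tau> \<le> d / 70 * \<tau>" by (rule abs_le_D1)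
  then show ?thesis unfolding m_def by (simp add: field_simps)
qed

text \<open>Smallness is taken from the sup norm of \<open>u\<close>: \<open>v $ i * u $ i\<close>
  is a small multiple of \<open>v $ i\<close>, which cancels the \<open>r\<close> of the derivative.
  The path length supplies the factor \<open>\<tau>\<close>.\<close>

lemma cross_term_Lipschitz:
  assumes \<theta>: "0 \<le> \<theta>" "\<theta> \<le> \<tau>"
  shows "\<bar>(\<Sum>i\<in>UNIV. w 0 $ i * (v $ i * u $ i)) - (\<Sum>i\<in>UNIV. w \<theta> $ i * (v $ i * u $ i))\<bar> \<le> d * \<delta> / 38 * \<tau>"
proof -
  define X where "X \<theta> = (\<Sum>i\<in>UNIV. w \<theta> $ i * (v $ i * u $ i))" for \<theta>
  have "\<bar>X 0 - X \<theta>\<bar> \<le> d * \<delta> / 38 * \<bar>0 - \<theta>\<bar>"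
  proof (rule derivative_bound_imp_Lipschitz)
    fix x assume x: "0 \<le> x" "x \<le> \<tau>"
    let ?n = "\<Sum>i\<in>UNIV. w x $ i * (v $ i * u $ i) * (y x $ i - z x $ i)"
    show "(X has_real_derivative r * ?n) (at x)"
      unfolding X_def by (rule sum_deriv [OF x])
    have "\<bar>?n\<bar> \<le> 2 * (1 / (80 * r)) * mat_norm (diag (w x)) v * mat_norm (diag (w x)) (y x)"
    proof (rule weighted_sum_diff_bound [OF w [OF x] _ _ z [OF x]])
      show "\<bar>v $ i * u $ i\<bar> \<le> 1 / (80 * r) * \<bar>v $ i\<bar>" for i
        using mult_right_mono [OF u_small [of i], of "\<bar>v $ i\<bar>"] by (simp add: abs_mult mult_ac)
    qed (use r in simp)
    also have "\<dots> \<le> 2 * (1 / (80 * r)) * ((1 + \<tau> / 70) * d) * ((1 + \<tau> / 25) * \<delta>)"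
      using r d_nonneg \<tau>_bounds(1,2)
      by (intro mult_left_mono mult_mono y_norm_\<delta> v_norm x mat_norm_diag_nonneg w) auto
    finally have "r * \<bar>?n\<bar> \<le> r * (2 * (1 / (80 * r)) * ((1 + \<tau> / 70) * d) * ((1 + \<tau> / 25) * \<delta>))"
      using r by (intro mult_left_mono) auto
    also have "\<dots> = ((1 + \<tau> / 70) * (1 + \<tau> / 25) / 40) * (d * \<delta>)"
      using r by (simp add: field_simps)
    also have "\<dots> \<le> 1 / 38 * (d * \<delta>)"
    proof (rule mult_right_mono)
      have "(1 + \<tau> / 70) * (1 + \<tau> / 25) \<le> 1 + \<tau> / 18"
        using one_plus_mult_le [of \<tau> "1/70" "1/25" "1/18"] \<tau>_bounds(1,2) by simp
      then have "(1 + \<tau> / 70) * (1 + \<tau> / 25) / 40 \<le> (1 + \<tau> / 18) / 40"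
        by (rule divide_right_mono) simp
      also have "\<dots> \<le> 1 / 38" using \<tau>_bounds(2) by simp
      finally show "(1 + \<tau> / 70) * (1 + \<tau> / 25) / 40 \<le> 1 / 38" .
    qed (simp add: d_nonneg \<delta>_nonneg)
    finally show "\<bar>r * ?n\<bar> \<le> d * \<delta> / 38" using r by (simp add: abs_mult)
  qed (use \<theta> in auto)
  also have "\<dots> \<le> d * \<delta> / 38 * \<tau>" using \<theta> d_nonneg \<delta>_nonneg by (intro mult_left_mono) auto
  finally show ?thesis by (simp add: X_def)
qed

text \<open>The assumption is the new Newton equation tested against the new Newton step, with \<open>t c\<close>
  eliminated by means of the old Newton equation.\<close>

lemma contraction:
  assumes d2: "d\<^sup>2 = (\<Sum>i\<in>UNIV. w 0 $ i * (1 + u $ i) * (1 - \<tau> * u $ i) * v $ i) - (\<Sum>i\<in>UNIV. w \<tau> $ i * v $ i)"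
  shows "d \<le> (1 - 1 / (4 * r)) * \<delta>"
proof -
  \<comment> \<open>The mean value theorem is applied to the scalar sum, not to each weight, so one
    intermediate point \<open>\<xi>\<close> serves all coordinates.\<close>
  obtain \<xi> where \<xi>: "0 < \<xi>" "\<xi> < \<tau>" and mvt:
    "(\<Sum>i\<in>UNIV. w \<tau> $ i * v $ i) - (\<Sum>i\<in>UNIV. w 0 $ i * v $ i)
      = (\<tau> - 0) * (r * (\<Sum>i\<in>UNIV. w \<xi> $ i * v $ i * (y \<xi> $ i - z \<xi> $ i)))"
    using MVT2 [OF \<tau>_bounds(1) sum_deriv] by blast
  have t: "0 \<le> \<xi>" "\<xi> \<le> \<tau>" using \<xi> by auto
  let ?N = "mat_norm (diag (w \<xi>))"
  \<comment> \<open>Expand \<open>(1 + u) (1 - \<tau> u) = 1 + (1 - \<tau>) u - \<tau> u^2\<close>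
    and split \<open>y \<xi> = u + (y \<xi> - u)\<close>. The four lines are the drift of the
    weights, the quadratic term, the drift of \<open>y\<close>, and the main term with
    \<open>z \<xi>\<close>.\<close>
  have d2_eq: "d\<^sup>2 = (1 - \<tau>) * ((\<Sum>i\<in>UNIV. w 0 $ i * (v $ i * u $ i)) - (\<Sum>i\<in>UNIV. w \<xi> $ i * (v $ i * u $ i)))
     - \<tau> * (\<Sum>i\<in>UNIV. w 0 $ i * v $ i * (u $ i)\<^sup>2)
     - (1 - \<tau>) * (\<Sum>i\<in>UNIV. w \<xi> $ i * v $ i * (y \<xi> $ i - u $ i))
     + (1 - \<tau>) * (\<Sum>i\<in>UNIV. w \<xi> $ i * v $ i * z \<xi> $ i)"
  proof -
    have "(\<Sum>i\<in>UNIV. w \<tau> $ i * v $ i) = (\<Sum>i\<in>UNIV. w 0 $ i * v $ i)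
      + (1 - \<tau>) * (\<Sum>i\<in>UNIV. w \<xi> $ i * v $ i * (y \<xi> $ i - z \<xi> $ i))"
      using mvt unfolding \<tau>_bounds(3) [symmetric] by (simp add: algebra_simps)
    then show ?thesis
      unfolding d2
      by (simp add: sum_distrib_left flip: sum.distrib sum_subtractf)
        (rule sum.cong, simp_all add: algebra_simps power2_eq_square)
  qed
  have dd: "0 \<le> d * \<delta>" by (simp add: d_nonneg \<delta>_nonneg)
  have e1: "(1 - \<tau>) * ((\<Sum>i\<in>UNIV. w 0 $ i * (v $ i * u $ i)) - (\<Sum>i\<in>UNIV. w \<xi> $ i * (v $ i * u $ i)))
      \<le> \<tau> / 38 * (d * \<delta>)" (is "(1 - \<tau>) * ?a \<le> _")
  proof -
    have "(1 - \<tau>) * ?a \<le> \<bar>1 - \<tau>\<bar> * \<bar>?a\<bar>"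
      unfolding abs_mult [symmetric] by (rule abs_ge_self)
    also have "\<dots> \<le> 1 * \<bar>?a\<bar>"
      using \<tau>_bounds(1,2) by (intro mult_right_mono) auto
    also have "\<dots> \<le> d * \<delta> / 38 * \<tau>"
      unfolding mult_1 by (rule cross_term_Lipschitz [OF t])
    finally show ?thesis by (simp add: mult_ac)
  qed
  have e2: "\<bar>\<tau> * (\<Sum>i\<in>UNIV. w 0 $ i * v $ i * (u $ i)\<^sup>2)\<bar> \<le> \<tau> / 70 * (d * \<delta>)"
  proof -
    have "\<bar>\<Sum>i\<in>UNIV. w 0 $ i * v $ i * (u $ i)\<^sup>2\<bar> \<le> 1/80 * (mat_norm (diag (w 0)) v * \<delta>)"
    proof (rule weighted_product_sum_bound)
      show "\<bar>(u $ i)\<^sup>2\<bar> \<le> 1/80 * \<bar>u $ i\<bar>" for i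
        using mult_right_mono [OF u_le [of i], of "\<bar>u $ i\<bar>"] by (simp add: power2_eq_square)
    qed (use w \<tau>_bounds(1,2) in auto)
    also have "\<dots> \<le> 1/80 * ((1 + \<tau> / 70) * d * \<delta>)"
      using \<tau>_bounds(1,2) \<delta>_nonneg by (intro mult_left_mono mult_right_mono v_norm) auto
    also have "\<dots> = ((1 + \<tau> / 70) / 80) * (d * \<delta>)" by simp
    also have "\<dots> \<le> 1 / 70 * (d * \<delta>)"
      using \<tau>_bounds(1,2) by (intro mult_right_mono dd) auto
    finally show ?thesis
      using \<tau>_bounds(1,2) by (simp add: abs_mult) 
  qed
  have e3: "\<bar>(1 - \<tau>) * (\<Sum>i\<in>UNIV. w \<xi> $ i * v $ i * (y \<xi> $ i - u $ i))\<bar> \<le> \<tau> / 70 * (d * \<delta>)"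
  proof -
    have "\<bar>(1 - \<tau>) * (\<Sum>i\<in>UNIV. w \<xi> $ i * v $ i * (y \<xi> $ i - u $ i))\<bar>
        \<le> 1 * \<bar>\<Sum>i\<in>UNIV. w \<xi> $ i * v $ i * (y \<xi> $ i - u $ i)\<bar>"
      unfolding abs_mult using \<tau>_bounds(1,2) by (intro mult_right_mono) auto
    also have "\<dots> \<le> \<tau> / 79 * (?N v * ?N u)"
      unfolding mult_1 using \<tau>_bounds(1,2)
      by (intro weighted_product_sum_bound w t y_minus_u) auto
    also have "\<dots> \<le> \<tau> / 79 * (((1 + \<tau> / 70) * d) * ((1 + \<tau> / 39) * \<delta>))"
      using \<tau>_bounds(1,2) d_nonneg
      by (intro mult_left_mono mult_mono v_norm u_norm t mat_norm_diag_nonneg w) auto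
    also have "\<dots> = (\<tau> * ((1 + \<tau> / 70) * (1 + \<tau> / 39) / 79)) * (d * \<delta>)" by simp
    also have "\<dots> \<le> (\<tau> * (1 / 70)) * (d * \<delta>)"
    proof (intro mult_right_mono mult_left_mono dd)
      have "(1 + \<tau> / 70) * (1 + \<tau> / 39) \<le> 1 + \<tau> / 24"
        using one_plus_mult_le [of \<tau> "1/70" "1/39" "1/24"] \<tau>_bounds(1,2) by simp
      then have "(1 + \<tau> / 70) * (1 + \<tau> / 39) / 79 \<le> (1 + \<tau> / 24) / 79"
        by (rule divide_right_mono) simp
      also have "\<dots> \<le> 1 / 70" using \<tau>_bounds(2) by simp
      finally show "(1 + \<tau> / 70) * (1 + \<tau> / 39) / 79 \<le> 1 / 70" .
    qed (use \<tau>_bounds(1) in simp)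
    finally show ?thesis by simp
  qed
  \<comment> \<open>The gain \<open>1 - \<tau>\<close> outweighs the norm errors, which together
    cost at most a factor \<open>1 + \<tau> / 10\<close>.\<close>
  have e4: "(1 - \<tau>) * (\<Sum>i\<in>UNIV. w \<xi> $ i * v $ i * z \<xi> $ i) \<le> (1 - \<tau> * (9/10)) * (d * \<delta>)"
  proof -
    have "\<bar>\<Sum>i\<in>UNIV. w \<xi> $ i * v $ i * z \<xi> $ i\<bar> \<le> 1 * (?N v * ?N (z \<xi>))"
      by (intro weighted_product_sum_bound w t) auto
    also have "\<dots> \<le> ((1 + \<tau> / 70) * d) * ((1 + \<tau> / 25) * \<delta>)"
      unfolding mult_1 using \<tau>_bounds(1,2) d_nonneg
      by (intro mult_mono v_norm order_trans [OF z y_norm_\<delta>] t mat_norm_diag_nonneg w) auto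
    finally have "(1 - \<tau>) * (\<Sum>i\<in>UNIV. w \<xi> $ i * v $ i * z \<xi> $ i) \<le>
        (1 - \<tau>) * (((1 + \<tau> / 70) * d) * ((1 + \<tau> / 25) * \<delta>))"
      using \<tau>_bounds(1,2) by (intro mult_left_mono) auto
    also have "\<dots> = ((1 - \<tau>) * ((1 + \<tau> / 70) * (1 + \<tau> / 25))) * (d * \<delta>)" by simp
    also have "\<dots> \<le> ((1 - \<tau>) * (1 + \<tau> / 10)) * (d * \<delta>)"
      using one_plus_mult_le [of \<tau> "1/70" "1/25" "1/10"] \<tau>_bounds(1,2)
      by (intro mult_right_mono mult_left_mono dd) auto
    also have "\<dots> \<le> (1 - \<tau> * (9/10)) * (d * \<delta>)"
    proof (rule mult_right_mono [OF _ dd])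
      have "(1 - \<tau>) * (1 + \<tau> / 10) = 1 - \<tau> * (9/10) - \<tau> * \<tau> / 10" by (simp add: field_simps)
      then show "(1 - \<tau>) * (1 + \<tau> / 10) \<le> 1 - \<tau> * (9/10)" by simp
    qed
    finally show ?thesis .
  qed
  have "d\<^sup>2 \<le> \<tau> / 38 * (d * \<delta>) + \<tau> / 70 * (d * \<delta>) + \<tau> / 70 * (d * \<delta>) + (1 - \<tau> * (9/10)) * (d * \<delta>)"
    unfolding d2_eq using e1 e2 e3 e4 by linarith
  also have "\<dots> = (1 - \<tau> * (9/10 - 1/38 - 1/70 - 1/70)) * (d * \<delta>)" by (simp add: algebra_simps)
  also have "\<dots> \<le> (1 - 1 / (4 * r)) * (d * \<delta>)"
  proof (rule mult_right_mono [OF _ dd])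
    \<comment> \<open>The bracket is about 0.84; one half already suffices, because
      \<open>\<tau> / 2\<close> dominates \<open>1 / (4 * r)\<close>.\<close>
    have "\<tau> * (1/2) \<le> \<tau> * (9/10 - 1/38 - 1/70 - 1/70)"
      using \<tau>_bounds(1) by (intro mult_left_mono) auto
    then show "1 - \<tau> * (9/10 - 1/38 - 1/70 - 1/70) \<le> 1 - 1 / (4 * r)"
      using \<tau>_bounds(4) by simp
  qed
  finally have "d * d \<le> d * ((1 - 1 / (4 * r)) * \<delta>)" by (simp add: power2_eq_square mult_ac)
  \<comment> \<open>Needed for \<open>d = 0\<close>, where the previous inequality cannot be divided
    by \<open>d\<close>.\<close>
  moreover have "0 \<le> (1 - 1 / (4 * r)) * \<delta>"
    using \<delta>_nonneg \<tau>_bounds(2,4) by (intro mult_nonneg_nonneg) linarith+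
  ultimately show ?thesis
    using d_nonneg by (cases "d = 0") auto
qed

end

section \<open>Application to the weight function\<close>

text \<open>Chain rule: the velocity of the slacks is \<open>- S y\<close>, and the definition of
  the step matrix \<open>B\<close> gives \<open>G' S = cr G (B - I)\<close>, so the derivative
  \<open>- G' S y\<close> equals \<open>cr G (y - B y)\<close>.\<close>

lemma weight_function_path_derivative:
  fixes A :: "real^'n^'m"
  assumes g: "weight_function A g c1 c\<gamma> cr" and s: "\<And>\<theta>. s \<theta> = (\<chi> i. s0 $ i * (1 - \<theta> * u $ i))"
    and pos: "s \<theta> \<in> positive_orthant"
    and y: "y = (\<chi> i. u $ i / (1 - \<theta> * u $ i))"
  shows "((\<lambda>\<theta>. g (s \<theta>) $ i) has_real_derivative
      cr * (g (s \<theta>) $ i * (y $ i - (step_matrix g cr (s \<theta>) *v y) $ i))) (at \<theta>)"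
proof -
  let ?J = "jacobian g (at (s \<theta>))" and ?p = "(\<chi> i. - (s0 $ i * u $ i)) :: real^'m"
  have cr: "cr \<ge> 1" and gpos: "g (s \<theta>) \<in> positive_orthant" and "g differentiable (at (s \<theta>))"
    using g pos by (auto simp: weight_function_def)
  then have g_deriv: "(g has_derivative (\<lambda>h. ?J *v h)) (at (s \<theta>))"
    by (simp add: jacobian_works)
  have s_eq: "s = (\<lambda>\<theta>. (\<chi> i. s0 $ i) + \<theta> *\<^sub>R ?p)"
    by (auto simp: s fun_eq_iff vec_eq_iff algebra_simps)
  have "(s has_derivative (\<lambda>t. t *\<^sub>R ?p)) (at \<theta>)"
    unfolding s_eq by (auto intro!: derivative_eq_intros)
  from has_derivative_compose [OF this g_deriv]
  have "((\<lambda>\<theta>. g (s \<theta>)) has_derivative (\<lambda>t. ?J *v (t *\<^sub>R ?p))) (at \<theta>)" .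
  from has_derivative_compose [OF this bounded_linear.has_derivative [OF bounded_linear_vec_nth has_derivative_ident]]
  have "((\<lambda>\<theta>. g (s \<theta>) $ i) has_derivative (\<lambda>t. (?J *v (t *\<^sub>R ?p)) $ i)) (at \<theta>)" .
  then have D: "((\<lambda>\<theta>. g (s \<theta>) $ i) has_real_derivative (?J *v ?p) $ i) (at \<theta>)"
    by (simp add: has_field_derivative_def matrix_vector_mult_scaleR mult_commute_abs)
  have nz: "1 - \<theta> * u $ i \<noteq> 0" for i
    using positive_orthantD(3) [OF pos, of i] by (simp add: s)
  have "diag (s \<theta>) *v y = - ?p"
    using nz by (simp add: vec_eq_iff s y)
  moreover have "?J *v (- ?p) = - (?J *v ?p)"
    using matrix_vector_mult_diff_distrib [of ?J 0 ?p] by simp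
  ultimately have "(step_matrix g cr (s \<theta>) *v y) $ i
      = y $ i - inverse cr * (inverse (g (s \<theta>) $ i) * (?J *v ?p) $ i)"
    by (simp add: step_matrix_def matrix_vector_mult_add_rdistrib matrix_inv_diag positive_orthantD [OF gpos]
        scaleR_matrix_vector_assoc [symmetric] flip: matrix_vector_mul_assoc)
  then have "y $ i - (step_matrix g cr (s \<theta>) *v y) $ i
      = inverse cr * (inverse (g (s \<theta>) $ i) * (?J *v ?p) $ i)"
    by linarith
  then have "cr * (g (s \<theta>) $ i * (y $ i - (step_matrix g cr (s \<theta>) *v y) $ i)) = (?J *v ?p) $ i"
    using cr positive_orthantD(3) [OF gpos, of i] by (simp only:) (simp add: field_simps)
  with D show ?thesis by simp
qed

theorem mainTheorem11:
  fixes A :: "real^'n^'m" and b :: "real^'m" and c :: "real^'n"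
    and g :: "real^'m \<Rightarrow> real^'m" and c1 c\<gamma> cr t :: real
    and x_old x_new :: "real^'n" and s_old s_new :: "real^'m"
  assumes "rank A = CARD('n)"
    and "weight_function A g c1 c\<gamma> cr"
    and "x_old \<in> interior_region A b"
    and "s_old = slack A b x_old"
    and "x_new = x_old - (1 / (1 + cr)) *\<^sub>R newton_step A b c t x_old (g s_old)"
    and "s_new = slack A b x_new"
    and "centrality A b c t x_old (g s_old) \<le> 1 / (80 * c\<gamma> * cr)"
  shows "x_new \<in> interior_region A b \<and>
    centrality A b c t x_new (g s_new) \<le> (1 - 1 / (4 * cr)) * centrality A b c t x_old (g s_old)"
proof -
  have cr: "cr \<ge> 1" and c\<gamma>: "c\<gamma> \<ge> 1"
    and gpos: "\<And>s. s \<in> positive_orthant \<Longrightarrow> g s \<in> positive_orthant"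
    and sens: "\<And>s. s \<in> positive_orthant \<Longrightarrow> slack_sensitivity A s (g s) \<le> c\<gamma>"
    and opn: "\<And>s. s \<in> positive_orthant \<Longrightarrow> mat_opnorm (diag (g s)) (step_matrix g cr s) \<le> 1"
    using assms(2) by (auto simp: weight_function_def)
  have interior_iff: "x \<in> interior_region A b \<longleftrightarrow> slack A b x \<in> positive_orthant" for x
    by (simp add: interior_region_def positive_orthant_def slack_def)
  have s_old: "s_old \<in> positive_orthant"
    using assms(3,4) by (simp add: interior_iff)
  define \<tau> where "\<tau> = 1 / (1 + cr)"
  have \<tau>: "0 < \<tau>" "\<tau> \<le> 1/2" using cr by (auto simp: \<tau>_def field_simps)
  define h where "h = newton_step A b c t x_old (g s_old)"
  define u where "u = (\<chi> i. (A *v h) $ i / s_old $ i)"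
  note old = newton_step_properties [OF assms(1) s_old gpos [OF s_old] assms(4) u_def [unfolded h_def]]
  have K: "c\<gamma> * mat_norm (diag (g s_old)) u \<le> 1 / (80 * cr)"
    using mult_left_mono [OF assms(7), of c\<gamma>] c\<gamma> by (simp add: old(1))
  have u_small: "\<bar>u $ i\<bar> \<le> 1 / (80 * cr)" for i
  proof -
    have "\<bar>u $ i\<bar> \<le> c\<gamma> * mat_norm (diag (g s_old)) u"
      using old(3) [of i] mult_right_mono [OF sens [OF s_old] mat_norm_diag_nonneg [OF gpos [OF s_old]], of u]
      by (simp add: old(1))
    with K show ?thesis by simp
  qed
  define s where "s \<theta> = (\<chi> i. s_old $ i * (1 - \<theta> * u $ i))" for \<theta>
  \<comment> \<open>Positivity is required on the whole segment, since the conditions on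
    \<open>g\<close> are available only at positive slacks.\<close>
  have s_pos: "s \<theta> \<in> positive_orthant" if "0 \<le> \<theta>" "\<theta> \<le> \<tau>" for \<theta>
  proof -
    have "\<bar>\<theta> * u $ i\<bar> \<le> 1/2 * (1/80)" for i
    proof -
      have "1 / (80 * cr) \<le> 1/80" using cr by (simp add: field_simps)
      then have "\<bar>u $ i\<bar> \<le> 1/80" using u_small [of i] by linarith
      then show ?thesis unfolding abs_mult using that \<tau> by (intro mult_mono) auto
    qed
    then have "\<theta> * u $ i < 1" for i by (rule le_less_trans [OF order_trans [OF abs_ge_self]]) simp
    then show ?thesis
      using positive_orthantD(1) [OF s_old] by (simp add: s_def positive_orthant_def)
  qed
  \<comment> \<open>Slacks are affine in the point, so the damped Newton step ends exactly at
    parameter \<open>\<tau>\<close> of the path.\<close>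
  have s_new_eq: "s_new = s \<tau>"
  proof -
    have "s_new = s_old - \<tau> *\<^sub>R (A *v h)"
      using assms(4,5,6)
      by (simp add: slack_def h_def \<tau>_def matrix_vector_mult_diff_distrib matrix_vector_mult_scaleR)
    also have "\<dots> = s \<tau>"
      using positive_orthantD(3) [OF s_old]
      by (simp add: s_def u_def vec_eq_iff algebra_simps)
    finally show ?thesis .
  qed
  then have s_new: "s_new \<in> positive_orthant" using s_pos \<tau> by simp
  have s0: "s 0 = s_old" by (simp add: s_def vec_eq_iff)
  define k where "k = newton_step A b c t x_new (g s_new)"
  define v where "v = (\<chi> i. (A *v k) $ i / s_new $ i)"
  note new = newton_step_properties [OF assms(1) s_new gpos [OF s_new] assms(6) v_def [unfolded k_def]]
  define y where "y \<theta> = (\<chi> i. u $ i / (1 - \<theta> * u $ i))" for \<theta>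
  \<comment> \<open>The norm comparison required of \<open>z\<close> is the operator norm condition
    on the step matrix at \<open>r = cr\<close>; the constant \<open>K\<close> is the sensitivity
    bound \<open>c\<gamma>\<close>.\<close>
  interpret weight_path "\<lambda>\<theta>. g (s \<theta>)" y "\<lambda>\<theta>. step_matrix g cr (s \<theta>) *v y \<theta>" u v cr \<tau> c\<gamma>
  proof
    fix \<theta> assume \<theta>: "0 \<le> \<theta>" "\<theta> \<le> \<tau>"
    show "g (s \<theta>) \<in> positive_orthant" by (intro gpos s_pos \<theta>)
    then show "mat_norm (diag (g (s \<theta>))) (step_matrix g cr (s \<theta>) *v y \<theta>) \<le> mat_norm (diag (g (s \<theta>))) (y \<theta>)"
      using mult_right_mono [OF opn [OF s_pos [OF \<theta>]] mat_norm_diag_nonneg, of "g (s \<theta>)" "y \<theta>"]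
      by (intro order_trans [OF mat_opnorm_diag_bound]) auto
    show "((\<lambda>\<theta>. g (s \<theta>) $ i) has_real_derivative
        cr * (g (s \<theta>) $ i * (y \<theta> $ i - (step_matrix g cr (s \<theta>) *v y \<theta>) $ i))) (at \<theta>)" for i
      by (rule weight_function_path_derivative [OF assms(2) s_def s_pos [OF \<theta>] y_def])
  next
    show "\<bar>v $ i\<bar> \<le> c\<gamma> * mat_norm (diag (g (s \<tau>))) v" for i
      using new(3) [of i] mult_right_mono [OF sens [OF s_new] mat_norm_diag_nonneg [OF gpos [OF s_new]], of v]
      unfolding new(1) s_new_eq [symmetric] by (rule order_trans)
    show "c\<gamma> * mat_norm (diag (g (s 0))) u \<le> 1 / (80 * cr)" unfolding s0 by (rule K)
    show "0 \<le> c\<gamma>" using c\<gamma> by simp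
  qed (fact cr \<tau>_def y_def u_small)+
  \<comment> \<open>The new step \<open>k\<close>, measured relative to the old slacks; the factor
    is the ratio of new to old slack.\<close>
  have v_old: "(A *v k) $ i / s_old $ i = (1 - \<tau> * u $ i) * v $ i" for i
    using positive_orthantD(3) [OF s_new, of i] positive_orthantD(3) [OF s_old, of i]
    by (simp add: v_def s_new_eq s_def)
  have v_new: "(A *v k) $ i / s_new $ i = v $ i" for i by (simp add: v_def)
  \<comment> \<open>Both Newton equations are tested against the same direction \<open>k\<close>, so
    that \<open>t * (k \<bullet> c)\<close> can be eliminated between them.\<close>
  have "(\<Sum>i\<in>UNIV. g s_old $ i * u $ i * ((1 - \<tau> * u $ i) * v $ i))
        = t * (k \<bullet> c) - (\<Sum>i\<in>UNIV. g s_old $ i * ((1 - \<tau> * u $ i) * v $ i))"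
    using old(2) [of k] by (simp only: v_old)
  moreover have "(mat_norm (diag (g s_new)) v)\<^sup>2 = t * (k \<bullet> c) - (\<Sum>i\<in>UNIV. g s_new $ i * v $ i)"
    using new(2) [of k]
    unfolding mat_norm_diag_power2 [OF gpos [OF s_new]]
    by (simp only: v_new power2_eq_square mult.assoc)
  moreover have "(\<Sum>i\<in>UNIV. g s_old $ i * (1 + u $ i) * (1 - \<tau> * u $ i) * v $ i) =
      (\<Sum>i\<in>UNIV. g s_old $ i * u $ i * ((1 - \<tau> * u $ i) * v $ i))
      + (\<Sum>i\<in>UNIV. g s_old $ i * ((1 - \<tau> * u $ i) * v $ i))"
    by (simp add: algebra_simps flip: sum.distrib)
  ultimately have "(mat_norm (diag (g s_new)) v)\<^sup>2 =
      (\<Sum>i\<in>UNIV. g s_old $ i * (1 + u $ i) * (1 - \<tau> * u $ i) * v $ i) - (\<Sum>i\<in>UNIV. g s_new $ i * v $ i)"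
    by simp
  then have "mat_norm (diag (g s_new)) v \<le> (1 - 1 / (4 * cr)) * mat_norm (diag (g s_old)) u"
    using contraction unfolding s_new_eq [symmetric] s0 by simp
  then show ?thesis
    using s_new unfolding interior_iff old(1) new(1) assms(6) [symmetric] by blast
qed

end
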